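(* Let $n\in\mathbb{N}$. If $\mathbf{y}=(y_1,\ldots,y_n)\in\mathbb{N}^n$ is minimally invariant, then $\mathbf{y}_{\vert_i}=(y_1,y_2,\ldots,y_i)$ is minimally invariant for all $i\in[n]$.
   Context: $\mathbb{N}=\{1,2,3,\ldots\}$ and $[k]=\{1,\ldots,k\}$. Let $\mathbf{y}=(y_1,\ldots,y_n)\in\mathbb{N}^n$ be car lengths and $m=\sum_{i=1}^n y_i$. A one-way street has spots $1,\ldots,m$, initially empty. Given preferences $\mathbf{x}=(x_1,\ldots,x_n)\in[m]^n$, cars $1,\ldots,n$ enter in this order; car $i$ parks in spots $j,j+1,\ldots,j+y_i-1$, where $j\ge x_i$ is the smallest integer such that $j+y_i-1\le m$ and all these spots are unoccupied; if no such $j$ exists, parking fails. If all cars park, $\mathbf{x}$ is a parking assortment for $\mathbf{y}$; $\mathsf{PA}_n(\mathbf{y})$ is the set of these. $\mathsf{PA}^{\mathrm{inv}}_n(\mathbf{y})$ is the set of (permutation) invariant parking assortments: those $\mathbf{x}\in\mathsf{PA}_n(\mathbf{y})$ all of whose rearrangements are also in $\mathsf{PA}_n(\mathbf{y})$ (with $\mathbf{y}$ fixed). A list $\mathbf{y}\in\mathbb{N}^n$ is called minimally invariant if $\mathsf{PA}^{\mathrm{inv}}_n(\mathbf{y})=\{(1^n)\}$, where $(1^n)$ is the list of $n$ ones. *)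

theory Defs
  imports "HOL-Library.Multiset"
begin

text \<open>
  Car lengths and preferences are lists of natural numbers, with the head belonging to the first
  car. Spots are numbered from 1. Car lengths are meant to be positive; this is a hypothesis where
  the notions are used, and is not built into the definitions.
\<close>

definition can_park_at :: "nat \<Rightarrow> nat set \<Rightarrow> nat \<Rightarrow> nat \<Rightarrow> nat \<Rightarrow> bool" where
  "can_park_at m occ x l j \<longleftrightarrow> x \<le> j \<and> j + l - 1 \<le> m \<and> {j..j + l - 1} \<inter> occ = {}"

definition parking_spot :: "nat \<Rightarrow> nat set \<Rightarrow> nat \<Rightarrow> nat \<Rightarrow> nat" where
  "parking_spot m occ x l = (LEAST j. can_park_at m occ x l j)"

text \<open>
  \<open>all_park m occ xs ys\<close>: on a street with spots \<open>1, \<dots>, m\<close>, those in \<open>occ\<close> being taken already,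
  every car parks when cars with preferences \<open>xs\<close> and lengths \<open>ys\<close> enter in list order.
\<close>

fun all_park :: "nat \<Rightarrow> nat set \<Rightarrow> nat list \<Rightarrow> nat list \<Rightarrow> bool" where
  "all_park m occ [] [] \<longleftrightarrow> True"
| "all_park m occ (x # xs) (l # ls) \<longleftrightarrow>
     (\<exists>j. can_park_at m occ x l j) \<and>
     (let j = parking_spot m occ x l in all_park m (occ \<union> {j..j + l - 1}) xs ls)"
| "all_park m occ _ _ \<longleftrightarrow> False"

definition parking_assortments :: "nat list \<Rightarrow> nat list set" where
  "parking_assortments ys =
     {xs. length xs = length ys \<and> set xs \<subseteq> {1..sum_list ys} \<and> all_park (sum_list ys) {} xs ys}"

definition invariant_parking_assortments :: "nat list \<Rightarrow> nat list set" where
  "invariant_parking_assortments ys =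
     {xs \<in> parking_assortments ys. \<forall>xs'. mset xs' = mset xs \<longrightarrow> xs' \<in> parking_assortments ys}"

definition minimally_invariant :: "nat list \<Rightarrow> bool" where
  "minimally_invariant ys \<longleftrightarrow>
     invariant_parking_assortments ys = {replicate (length ys) 1}"

end

theory Submission
  imports Defs
begin

text \<open>
  When an invariant assortment is parked with its maximum \<open>w\<close> at an arbitrary position and its
  other entries in increasing order, each of the latter is at most the first free spot: otherwise
  that spot would stay empty. So each of these cars parks as if it preferred spot 1, and therefore
  \<open>(1, \<dots>, 1, w)\<close> is invariant. Hence a length list that is not minimally invariant has an
  invariant assortment \<open>(1, \<dots>, 1, w)\<close> with \<open>w > 1\<close>. Such a list stays invariant when further cars
  with preference 1 are added, because the first cars fill an initial segment of the street that
  contains \<open>w\<close>.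
\<close>

section \<open>Counting free spots and lowering preferences to 1\<close>

lemma can_park_at_parking_spot:
  assumes "\<exists>j. can_park_at m occ x l j"
  shows "can_park_at m occ x l (parking_spot m occ x l)"
  unfolding parking_spot_def using assms by (rule LeastI_ex)

lemma all_park_length: "all_park m occ xs ys \<Longrightarrow> length xs = length ys"
  by (induction m occ xs ys rule: all_park.induct) (auto simp: Let_def)

text \<open>With \<open>k = 1\<close> this preserves the invariant that the free spots number
  exactly the total length of the cars to come. The additive form avoids truncated
  subtraction.\<close>

lemma card_free_after_parking:
  assumes "can_park_at m occ x l j" "1 \<le> l" "k \<le> x"
  shows "card ({k..m} - (occ \<union> {j..j + l - 1})) + l = card ({k..m} - occ)"
proof -
  have sub: "{j..j + l - 1} \<subseteq> {k..m} - occ"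
    using assms by (auto simp: can_park_at_def)
  have "{k..m} - (occ \<union> {j..j + l - 1}) = ({k..m} - occ) - {j..j + l - 1}"
    by blast
  moreover have "card {j..j + l - 1} = l"
    using assms by simp
  moreover have "card {j..j + l - 1} \<le> card ({k..m} - occ)"
    by (rule card_mono) (use sub in auto)
  ultimately show ?thesis
    using card_Diff_subset[OF _ sub] by simp
qed

text \<open>No car parks before its preference, so the blocks of these cars are disjoint sets of
  free spots from \<open>k\<close> on.\<close>

lemma sum_list_le_card_free:
  assumes "all_park m occ xs ys" "\<forall>l\<in>set ys. 1 \<le> l" "\<forall>x\<in>set xs. k \<le> x"
  shows "sum_list ys \<le> card ({k..m} - occ)"
  using assms
proof (induction m occ xs ys rule: all_park.induct)
  case (2 m occ x xs l ls)
  let ?j = "parking_spot m occ x l"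
  have "can_park_at m occ x l ?j"
    using "2.prems" by (intro can_park_at_parking_spot) simp
  then have "card ({k..m} - (occ \<union> {?j..?j + l - 1})) + l = card ({k..m} - occ)"
    by (rule card_free_after_parking) (use "2.prems" in auto)
  with "2.IH"[OF refl] "2.prems" show ?case
    by (simp add: Let_def)
qed auto

text \<open>As the lengths exactly exhaust the free spots, every free spot gets covered. One before
  the minimum preference \<open>x\<close> never would be, so preference 1 admits no new start.
  Equality of the predicates makes the two \<open>parking_spot\<close> values equal by
  unfolding.\<close>

lemma parking_spot_min_preference:
  assumes park: "all_park m occ (x # xs) (l # ls)"
    and pos: "\<forall>l'\<in>set (l # ls). 1 \<le> l'"
    and "1 \<le> x" and min: "\<forall>x'\<in>set xs. x \<le> x'"
    and full: "card ({1..m} - occ) = sum_list (l # ls)"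
  shows "can_park_at m occ 1 l = can_park_at m occ x l"
proof
  fix j
  have "x \<le> j" if j: "can_park_at m occ 1 l j"
  proof (rule ccontr)
    assume "\<not> x \<le> j"
    have "1 \<le> l"
      using pos by simp
    then have "j \<in> {j..j + l - 1}"
      by simp
    with j have "j \<in> {1..m} - occ"
      using pos by (auto simp: can_park_at_def)
    with \<open>\<not> x \<le> j\<close> \<open>1 \<le> x\<close> have "{x..m} - occ \<subset> {1..m} - occ"
      by auto
    then have "card ({x..m} - occ) < card ({1..m} - occ)"
      by (intro psubset_card_mono) auto
    moreover have "sum_list (l # ls) \<le> card ({x..m} - occ)"
      using min by (intro sum_list_le_card_free[OF park pos]) auto
    ultimately show False
      using full by simp
  qed
  with \<open>1 \<le> x\<close> show "can_park_at m occ 1 l j = can_park_at m occ x l j"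
    by (auto simp: can_park_at_def)
qed

text \<open>Each car of \<open>u\<close> has the least preference among those to come, so
  \<open>parking_spot_min_preference\<close> applies in turn and the occupied sets do not change.
  \<open>tail\<close> ranges over all \<open>occ\<close> and \<open>ys\<close> because the state
  reached after \<open>u\<close> is not known in advance.\<close>

lemma all_park_replace_min:
  assumes "all_park m occ (u @ v) ys" "\<forall>l\<in>set ys. 1 \<le> l"
    and "\<forall>x\<in>set (u @ v). 1 \<le> x"
    and "sorted u" "\<forall>x\<in>set u. \<forall>x'\<in>set v. x \<le> x'"
    and "card ({1..m} - occ) = sum_list ys"
    and tail: "\<And>occ ys. \<lbrakk>all_park m occ v ys; \<forall>l\<in>set ys. 1 \<le> l; card ({1..m} - occ) = sum_list ys\<rbrakk>
      \<Longrightarrow> all_park m occ v' ys"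
  shows "all_park m occ (replicate (length u) 1 @ v') ys"
  using assms(1-6)
proof (induction u arbitrary: occ ys)
  case Nil
  then show ?case
    using tail by simp
next
  case (Cons x u)
  from Cons.prems(1) obtain l ls where ys: "ys = l # ls"
    by (cases ys) auto
  let ?j = "parking_spot m occ x l"
  have eq: "can_park_at m occ 1 l = can_park_at m occ x l"
    by (rule parking_spot_min_preference[where xs = "u @ v" and ls = ls])
      (use Cons.prems ys in auto)
  then have spot: "parking_spot m occ 1 l = ?j"
    by (simp add: parking_spot_def)
  have ex: "\<exists>j. can_park_at m occ x l j"
    using Cons.prems(1) ys by simp
  have "card ({1..m} - (occ \<union> {?j..?j + l - 1})) + l = card ({1..m} - occ)"
    by (rule card_free_after_parking[OF can_park_at_parking_spot[OF ex]])
      (use Cons.prems ys in auto)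
  then have "all_park m (occ \<union> {?j..?j + l - 1}) (replicate (length u) 1 @ v') ls"
    by (intro Cons.IH) (use Cons.prems ys in \<open>auto simp: Let_def\<close>)
  then show ?case
    using ex eq spot by (simp add: ys Let_def)
qed

text \<open>\<open>w\<close> keeps its preference, since free spots before it may be left for the
  cars of \<open>v\<close>. The cars on either side of it are lowered by two uses of
  \<open>all_park_replace_min\<close>.\<close>

lemma all_park_max_and_ones:
  assumes park: "all_park m occ (u @ w # v) ys" and pos: "\<forall>l\<in>set ys. 1 \<le> l"
    and ge: "\<forall>x\<in>set (u @ w # v). 1 \<le> x"
    and sorted: "sorted (u @ v)" and max: "\<forall>x\<in>set (u @ v). x \<le> w"
    and full: "card ({1..m} - occ) = sum_list ys"
  shows "all_park m occ (replicate (length u) 1 @ w # replicate (length v) 1) ys"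
proof (rule all_park_replace_min[OF park pos ge])
  fix occ ys
  assume park: "all_park m occ (w # v) ys" and pos: "\<forall>l\<in>set ys. 1 \<le> l"
    and full: "card ({1..m} - occ) = sum_list ys"
  from park obtain l ls where ys: "ys = l # ls"
    by (cases ys) auto
  let ?j = "parking_spot m occ w l"
  have ex: "\<exists>j. can_park_at m occ w l j"
    using park ys by simp
  have "card ({1..m} - (occ \<union> {?j..?j + l - 1})) + l = card ({1..m} - occ)"
    by (rule card_free_after_parking[OF can_park_at_parking_spot[OF ex]])
      (use pos ge ys in auto)
  \<comment> \<open>The preferences after \<open>w\<close> are sorted, so all of them are lowered
    and the tail is empty.\<close>
  then have "all_park m (occ \<union> {?j..?j + l - 1}) (replicate (length v) 1 @ []) ls"
    by (intro all_park_replace_min[where v = "[]"])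
      (use park pos full ge sorted ys in \<open>auto simp: Let_def sorted_append\<close>)
  then show "all_park m occ (w # replicate (length v) 1) ys"
    using ex by (simp add: ys Let_def)
qed (use sorted max full in \<open>auto simp: sorted_append\<close>)

section \<open>Filling the street from the left and lengthening it\<close>

lemma all_park_contiguous:
  assumes "length xs = length ys" "\<forall>l\<in>set ys. 1 \<le> l"
    and "\<forall>x\<in>set xs. 1 \<le> x \<and> x \<le> s + 1" and "s + sum_list ys \<le> m"
  shows "all_park m {1..s} xs ys"
  using assms
proof (induction xs ys arbitrary: s rule: list_induct2)
  case (Cons x xs l ls)
  have can: "can_park_at m {1..s} x l (s + 1)"
    using Cons.prems by (auto simp: can_park_at_def)
  \<comment> \<open>An admissible start is at least \<open>x \<ge> 1\<close>, so one up to
    \<open>s\<close> would itself be an occupied spot.\<close>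
  have "s + 1 \<le> j" if "can_park_at m {1..s} x l j" for j
  proof (rule ccontr)
    assume "\<not> s + 1 \<le> j"
    with that Cons.prems have "j \<in> {j..j + l - 1} \<inter> {1..s}"
      by (auto simp: can_park_at_def)
    with that show False
      by (auto simp: can_park_at_def)
  qed
  with can have spot: "parking_spot m {1..s} x l = s + 1"
    unfolding parking_spot_def by (intro Least_equality)
  have occ: "{1..s} \<union> {s + 1..s + 1 + l - 1} = {1..s + l}"
    by auto
  \<comment> \<open>The occupied set is again an initial segment, and the bound on preferences has
    only risen.\<close>
  have "all_park m {1..s + l} xs ls"
    by (rule Cons.IH) (use Cons.prems in auto)
  with can show ?case
    unfolding all_park.simps spot Let_def occ by blast
qed simp

text \<open>A block starting before the old one also ends before it, hence within \<open>m\<close>;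
  so lengthening the street adds only later starts.\<close>

lemma parking_spot_longer_street:
  assumes "\<exists>j. can_park_at m occ x l j" "m \<le> m'"
  shows "can_park_at m' occ x l (parking_spot m occ x l)"
    and "parking_spot m' occ x l = parking_spot m occ x l"
proof -
  let ?j = "parking_spot m occ x l"
  have j: "can_park_at m occ x l ?j"
    using assms(1) by (rule can_park_at_parking_spot)
  then show *: "can_park_at m' occ x l ?j"
    using assms(2) by (auto simp: can_park_at_def)
  have "?j \<le> i" if i: "can_park_at m' occ x l i" for i
  proof (rule ccontr)
    assume "\<not> ?j \<le> i"
    with i j have "can_park_at m occ x l i"
      by (auto simp: can_park_at_def)
    then have "?j \<le> i"
      unfolding parking_spot_def by (rule Least_le)
    with \<open>\<not> ?j \<le> i\<close> show False ..
  qed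
  with * show "parking_spot m' occ x l = ?j"
    unfolding parking_spot_def[of m'] by (intro Least_equality)
qed

text \<open>By the counting invariant the cars of \<open>xs\<close> fill \<open>{1..m}\<close>
  completely, so those of \<open>us\<close> meet exactly that occupied set.\<close>

lemma all_park_append:
  assumes "all_park m occ xs ys" "\<forall>l\<in>set ys. 1 \<le> l" "\<forall>x\<in>set xs. 1 \<le> x"
    and "occ \<subseteq> {1..m}" "card ({1..m} - occ) = sum_list ys"
    and "m \<le> m'" "all_park m' {1..m} us zs"
  shows "all_park m' occ (xs @ us) (ys @ zs)"
  using assms
proof (induction m occ xs ys rule: all_park.induct)
  case (1 m occ)
  \<comment> \<open>No length remains, so no spot of \<open>{1..m}\<close> is free.\<close>
  then have "occ = {1..m}"
    by auto
  with 1 show ?case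
    by simp
next
  case (2 m occ x xs l ls)
  let ?j = "parking_spot m occ x l"
  have ex: "\<exists>j. can_park_at m occ x l j"
    using "2.prems" by simp
  note can = can_park_at_parking_spot[OF ex]
  have "card ({1..m} - (occ \<union> {?j..?j + l - 1})) + l = card ({1..m} - occ)"
    by (rule card_free_after_parking[OF can]) (use "2.prems" in auto)
  moreover have "{?j..?j + l - 1} \<subseteq> {1..m}"
    using can "2.prems" by (auto simp: can_park_at_def)
  ultimately have "all_park m' (occ \<union> {?j..?j + l - 1}) (xs @ us) (ls @ zs)"
    by (intro "2.IH"[OF refl]) (use "2.prems" in \<open>auto simp: Let_def\<close>)
  with parking_spot_longer_street[OF ex \<open>m \<le> m'\<close>] show ?case
    by (auto simp: Let_def)
qed auto

section \<open>Invariant assortments with at most one entry other than 1\<close>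

lemma replicate_1_invariant:
  assumes "\<forall>l\<in>set ys. 1 \<le> l"
  shows "replicate (length ys) 1 \<in> invariant_parking_assortments ys"
proof -
  have "1 \<le> sum_list ys" if "ys \<noteq> []"
    using that assms by (cases ys) auto
  then have "replicate (length ys) 1 \<in> parking_assortments ys"
    using all_park_contiguous[of "replicate (length ys) 1" ys 0 "sum_list ys"] assms
    by (auto simp: parking_assortments_def)
  moreover have "xs = replicate (length ys) 1" if "mset xs = mset (replicate (length ys) 1)" for xs
    using that by (metis mset_eq_length mset_eq_setD replicate_length_same length_replicate
        in_set_replicate)
  ultimately show ?thesis
    unfolding invariant_parking_assortments_def mem_Collect_eq by metis
qed

lemma mset_eq_single_replicateE:
  assumes "mset xs = mset (w # replicate k c)"
  obtains a b where "xs = replicate a c @ w # replicate b c" "a + b = k"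
proof -
  have "w \<in> set xs"
    using assms by (metis list.set_intros(1) mset_eq_setD)
  then obtain u v where xs: "xs = u @ w # v"
    by (auto simp: in_set_conv_decomp)
  with assms have uv: "mset (u @ v) = mset (replicate k c)"
    by simp
  then have "set (u @ v) = set (replicate k c)" "length (u @ v) = k"
    using mset_eq_setD mset_eq_length by (blast, metis length_replicate)
  then have "\<forall>z\<in>set (u @ v). z = c" and k: "length u + length v = k"
    by (auto simp: set_replicate_conv_if split: if_splits)
  then have "u = replicate (length u) c" "v = replicate (length v) c"
    by (auto intro!: replicate_eqI)
  with xs k that show ?thesis
    by metis
qed

lemma not_minimally_invariantE:
  assumes pos: "\<forall>l\<in>set ys. 1 \<le> l" and "\<not> minimally_invariant ys"
  obtains w where "1 < w" "w # replicate (length ys - 1) 1 \<in> invariant_parking_assortments ys"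
proof -
  \<comment> \<open>The all-ones list is always invariant, so failure of minimality yields another
    invariant list.\<close>
  obtain x where x: "x \<in> invariant_parking_assortments ys" "x \<noteq> replicate (length ys) 1"
    using assms replicate_1_invariant[OF pos] unfolding minimally_invariant_def by blast
  define m where "m = sum_list ys"
  have perm: "xs \<in> parking_assortments ys" if "mset xs = mset x" for xs
    using x(1) that by (simp add: invariant_parking_assortments_def)
  have len: "length x = length ys" and range: "set x \<subseteq> {1..m}"
    using perm[OF refl] by (auto simp: parking_assortments_def m_def)
  have "x \<noteq> []"
    using x(2) len by auto
  then have ne: "sort x \<noteq> []"
    by (metis mset.simps(1) mset_sort mset_zero_iff)
  define w where "w = last (sort x)"
  define u where "u = butlast (sort x)"
  have sort: "sort x = u @ [w]"
    using ne by (simp add: u_def w_def)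
  then have sorted: "sorted (u @ [w])"
    by (metis sorted_sort)
  have mset: "mset x = mset (u @ [w])"
    using sort by (metis mset_sort)
  have set: "set x = insert w (set u)"
    using mset_eq_setD[OF mset] by simp
  have lenu: "Suc (length u) = length ys"
    using mset_eq_length[OF mset] len by simp
  have max: "\<forall>z\<in>set x. z \<le> w"
    using sorted set by (auto simp: sorted_append)
  have "\<exists>z\<in>set x. z \<noteq> 1"
    using x(2) len by (metis replicate_eqI)
  with range max have "1 < w"
    by fastforce
  moreover have "xs \<in> parking_assortments ys"
    if "mset xs = mset (w # replicate (length ys - 1) 1)" for xs
  proof -
    from that obtain a b where xs: "xs = replicate a 1 @ w # replicate b 1"
      and ab: "a + b = length ys - 1"
      by (rule mset_eq_single_replicateE)
    \<comment> \<open>Invariance of \<open>x\<close> is used for the rearrangement that has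
      \<open>w\<close> in the position it has in \<open>xs\<close> and the other entries in
      increasing order.\<close>
    have "mset u = mset (take a u) + mset (drop a u)"
      by (metis append_take_drop_id mset_append)
    then have "mset (take a u @ w # drop a u) = mset x"
      by (simp add: mset)
    then have "all_park m {} (take a u @ w # drop a u) ys"
      using perm by (simp add: parking_assortments_def m_def)
    then have "all_park m {} (replicate (length (take a u)) 1 @ w #
        replicate (length (drop a u)) 1) ys"
      by (rule all_park_max_and_ones)
        (use pos sorted max range set in
          \<open>auto simp: m_def sorted_append dest!: in_set_takeD in_set_dropD\<close>)
    moreover have "length (take a u) = a" "length (drop a u) = b"
      using ab lenu by auto
    ultimately have "all_park m {} xs ys"
      by (simp add: xs)
    moreover have "set xs \<subseteq> {1..m}"
      using xs range set \<open>1 < w\<close> by auto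
    ultimately show ?thesis
      using all_park_length by (auto simp: parking_assortments_def m_def)
  qed
  ultimately show ?thesis
    using that by (simp add: invariant_parking_assortments_def)
qed

lemma invariant_append:
  assumes pos: "\<forall>l\<in>set (ys @ zs). 1 \<le> l" and "ys \<noteq> []"
    and inv: "w # replicate (length ys - 1) 1 \<in> invariant_parking_assortments ys"
  shows "w # replicate (length (ys @ zs) - 1) 1 \<in> invariant_parking_assortments (ys @ zs)"
proof -
  define m where "m = sum_list ys"
  define M where "M = sum_list (ys @ zs)"
  have perm: "xs \<in> parking_assortments ys" if "mset xs = mset (w # replicate (length ys - 1) 1)" for xs
    using inv that by (simp add: invariant_parking_assortments_def)
  have w: "w \<in> {1..m}"
    using perm[OF refl] by (auto simp: parking_assortments_def m_def)
  have "xs \<in> parking_assortments (ys @ zs)"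
    if "mset xs = mset (w # replicate (length (ys @ zs) - 1) 1)" for xs
  proof -
    from that obtain a b where xs: "xs = replicate a 1 @ w # replicate b 1"
      and ab: "a + b = length (ys @ zs) - 1"
      by (rule mset_eq_single_replicateE)
    have len: "length xs = length (ys @ zs)"
      using xs ab \<open>ys \<noteq> []\<close> by (cases ys) auto
    have set: "set xs \<subseteq> {1, w}"
      using xs by auto
    define us where "us = take (length ys) xs"
    define vs where "vs = drop (length ys) xs"
    have split: "xs = us @ vs"
      by (simp add: us_def vs_def)
    have setu: "set us \<subseteq> {1, w}" and setv: "set vs \<subseteq> {1, w}"
      using set split by auto
    have "all_park m {} us ys"
    \<comment> \<open>If \<open>w\<close> falls among the first \<open>length ys\<close> cars, they
      carry a rearrangement of the given invariant list; otherwise all of them prefer 1.\<close>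
    proof (cases "a < length ys")
      case True
      have "us = replicate a 1 @ w # replicate (length ys - 1 - a) 1"
        using True ab by (auto simp: us_def xs min_def take_Cons')
      moreover have "a + (length ys - 1 - a) = length ys - 1"
        using True by simp
      then have "replicate (length ys - 1) 1 = replicate a 1 @ replicate (length ys - 1 - a) (1::nat)"
        by (metis replicate_add)
      ultimately have "us \<in> parking_assortments ys"
        by (intro perm) simp
      then show ?thesis
        by (simp add: parking_assortments_def m_def)
    next
      case False
      then have "us = replicate (length ys) 1"
        by (simp add: us_def xs)
      then show ?thesis
        using all_park_contiguous[of us ys 0 m] pos by (auto simp: m_def)
    qed
    \<comment> \<open>Since \<open>w\<close> lies in \<open>{1..m}\<close>, every preference in
      \<open>vs\<close> lies in the filled segment.\<close>
    moreover have "all_park M {1..m} vs zs"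
      by (rule all_park_contiguous)
        (use len pos setv w in \<open>auto simp: vs_def M_def m_def\<close>)
    ultimately have "all_park M {} xs (ys @ zs)"
      unfolding split
      by (intro all_park_append) (use pos setu w in \<open>auto simp: M_def m_def\<close>)
    moreover have "set xs \<subseteq> {1..M}"
      using set w by (auto simp: M_def m_def)
    ultimately show ?thesis
      using len by (simp add: parking_assortments_def M_def)
  qed
  then show ?thesis
    by (simp add: invariant_parking_assortments_def)
qed

theorem corollary4p7:
  fixes n :: nat and y :: "nat list"
  assumes "n \<ge> 1"
    and "length y = n"
    and "\<forall>l\<in>set y. l \<ge> 1"
    and "minimally_invariant y"
  shows "\<forall>i\<in>{1..n}. minimally_invariant (take i y)"
proof (rule ballI, rule ccontr)
  fix i assume i: "i \<in> {1..n}" and not_min: "\<not> minimally_invariant (take i y)"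
  have "\<forall>l\<in>set (take i y). 1 \<le> l"
    using assms(3) by (auto dest: in_set_takeD)
  then obtain w where "1 < w"
    and "w # replicate (length (take i y) - 1) 1 \<in> invariant_parking_assortments (take i y)"
    using not_min by (rule not_minimally_invariantE)
  moreover have "take i y \<noteq> []"
    using i assms(2) by auto
  ultimately have "w # replicate (n - 1) 1 \<in> invariant_parking_assortments y"
    using invariant_append[of "take i y" "drop i y" w] assms(2,3) by simp
  then have "w # replicate (n - 1) 1 = replicate n 1"
    using assms(2,4) by (simp add: minimally_invariant_def)
  \<comment> \<open>Comparing the heads of the two lists gives \<open>w = 1\<close>.\<close>
  with \<open>1 < w\<close> assms(1) show False
    by (cases n) auto
qed

end
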